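(* Consider a linear cake-eating problem on $X=[0,b]$, $b>0$, and let $T\in\mathbb{N}^0$. For $x\in X$, let $\langle x_t^*(x)\mid t\ge T\rangle$ be the sequence with $x_t^*(x)=x$ for all $t\ge T$. (i) If $V^{T+1}$ is non-decreasing on $X$, then for all $x\in X$, $x\in h^T(x)$. (ii) If $V^{T+1}$ is strictly increasing on $X$, then for all $x\in X$, $h^T(x)=\{x\}$. (iii) If $V^t$ is non-decreasing on $X$ for all $t>T$, then for all $x\in X$, $\langle x_t^*(x)\mid t\ge T\rangle\in\mathcal{S}^T(x)$.
   Context: $\mathbb{N}^0=\{0,1,2,\dots\}$. A linear cake-eating problem on $X=[0,b]$ is given by a sequence of real numbers $\langle p^{(t)}\mid t\in\mathbb{N}^0\rangle$ with $\sum_{t=0}^\infty|p^{(t)}|<+\infty$, together with the constraint sets $\Omega_t=\Omega=\{(z,y)\mid z\in[0,b],\ y\in[0,z]\}$ for all $t\in\mathbb{N}^0$. For $T\in\mathbb{N}^0$ and $y\in X$, $\mathcal{F}^T(y)$ is the set of sequences $\langle x_t\mid t\ge T\rangle$ in $X$ with $x_T=y$ and $(x_t,x_{t+1})\in\Omega$ (i.e. $x_{t+1}\le x_t$) for all $t\ge T$; $\mathcal{S}^T(y)$ is the set of maximizers of $\sum_{t=T}^\infty p^{(t)}x_t$ over $\langle x_t\mid t\ge T\rangle\in\mathcal{F}^T(y)$. The set $\mathcal{S}^T(y)$ is non-empty for every $y\in X$, and $V^T:X\to\mathbb{R}$ is defined by $V^T(y)=\sum_{t=T}^\infty p^{(t)}x_t$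 for any $\langle x_t\mid t\ge T\rangle\in\mathcal{S}^T(y)$. The optimal period-$T$ decision rule is the set-valued map $h^T(x)=\operatorname{argmax}_{y\in[0,x]}V^{T+1}(y)$, $x\in X$. *)

theory Defs
  imports "HOL-Analysis.Analysis" "HOL-Library.FuncSet"
begin

definition cake_constraint :: "real \<Rightarrow> (real \<times> real) set" where
  "cake_constraint b = {(z, y). z \<in> {0..b} \<and> y \<in> {0..z}}"

text \<open>A sequence indexed by the periods from T on is an extensional function on \<open>{T..}\<close>
  (equal to \<open>undefined\<close> before T), so that function equality is equality of such sequences.\<close>

definition feasible_plans :: "real \<Rightarrow> nat \<Rightarrow> real \<Rightarrow> (nat \<Rightarrow> real) set" where
  "feasible_plans b T y =
     {x \<in> {T..} \<rightarrow>\<^sub>E {0..b}. x T = y \<and> (\<forall>t\<ge>T. (x t, x (Suc t)) \<in> cake_constraint b)}"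

definition payoff :: "(nat \<Rightarrow> real) \<Rightarrow> nat \<Rightarrow> (nat \<Rightarrow> real) \<Rightarrow> real" where
  "payoff p T x = (\<Sum>t. p (t + T) * x (t + T))"

definition optimal_plans :: "real \<Rightarrow> (nat \<Rightarrow> real) \<Rightarrow> nat \<Rightarrow> real \<Rightarrow> (nat \<Rightarrow> real) set" where
  "optimal_plans b p T y = {x. is_arg_max (payoff p T) (\<lambda>x. x \<in> feasible_plans b T y) x}"

text \<open>The common payoff of all optimal plans. Maximizers have equal payoffs, so the set of
  optimal payoffs is a singleton as soon as an optimal plan exists.\<close>

definition value_fun :: "real \<Rightarrow> (nat \<Rightarrow> real) \<Rightarrow> nat \<Rightarrow> real \<Rightarrow> real" where
  "value_fun b p T y = the_elem (payoff p T ` optimal_plans b p T y)"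

lemma value_fun_eq_payoff:
  assumes "x \<in> optimal_plans b p T y"
  shows "value_fun b p T y = payoff p T x"
proof -
  have "payoff p T ` optimal_plans b p T y = {payoff p T x}"
    using assms unfolding optimal_plans_def is_arg_max_def by force
  then show ?thesis
    by (simp add: value_fun_def)
qed

definition decision_rule :: "real \<Rightarrow> (nat \<Rightarrow> real) \<Rightarrow> nat \<Rightarrow> real \<Rightarrow> real set" where
  "decision_rule b p T x = {y. is_arg_max (value_fun b p (Suc T)) (\<lambda>y. y \<in> {0..x}) y}"

end

theory Submission
  imports Defs
begin

text \<open>Optimal plans exist explicitly: by Abel summation the payoff of a non-increasing plan starting
  at \<open>y\<close> is at most \<open>y\<close> times the supremum of the partial sums of the prices, and this bound
  is attained either by eating everything at once after a period in which the partial sums are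
  maximal, or, if there is none, by never eating. For part (iii), monotonicity of the later value
  functions gives \<open>V\<^sup>T(x) \<le> p\<^sup>T x + V\<^sup>T\<^sup>+\<^sup>1(x)\<close>; iterating this, and using that the value functions
  tend to \<open>0\<close>, bounds every payoff by that of the constant plan.\<close>

section \<open>Real sequences: maxima and summation by parts\<close>

lemma convergent_max_or_le_limit:
  fixes f :: "nat \<Rightarrow> real"
  assumes "f \<longlonglongrightarrow> l"
  shows "(\<forall>m. f m \<le> l) \<or> (\<exists>n. \<forall>m. f m \<le> f n)"
proof (rule disjCI)
  assume no_max: "\<not> (\<exists>n. \<forall>m. f m \<le> f n)"
  show "\<forall>m. f m \<le> l"
  proof (rule ccontr)
    assume "\<not> (\<forall>m. f m \<le> l)"
    then obtain k where "l < f k"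
      by (auto simp: not_le)
    \<comment> \<open>Only finitely many terms reach a value above the limit, so a maximum over a
      long enough initial segment is global.\<close>
    then have "\<forall>\<^sub>F m in sequentially. f m < f k"
      using assms by (simp add: order_tendsto_iff)
    then obtain N where N: "\<And>m. m \<ge> N \<Longrightarrow> f m < f k"
      by (auto simp: eventually_sequentially)
    \<comment> \<open>The segment includes \<open>k\<close>, so its maximum is at least
      \<open>f k\<close> and dominates the later terms too.\<close>
    let ?F = "f ` {..max N k}"
    have "Max ?F \<in> ?F"
      by (rule Max_in) auto
    then obtain n where n: "f n = Max ?F"
      by (metis imageE)
    have "f m \<le> f n" for m
    proof (cases "m \<le> max N k")
      case True
      then show ?thesis
        by (simp add: n)
    next
      case False
      then have "f m \<le> f k"
        by (intro less_imp_le N) auto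
      also have "f k \<le> f n"
        by (simp add: n)
      finally show ?thesis .
    qed
    with no_max show False
      by blast
  qed
qed

lemma abel_sum_le:
  fixes q a :: "nat \<Rightarrow> real"
  assumes "antimono a" "\<And>n. a n \<ge> 0" and M: "\<And>n. sum q {..n} \<le> M"
  shows "(\<Sum>i\<le>n. q i * a i) \<le> a 0 * M"
proof -
  \<comment> \<open>Summation by parts as an invariant: each past decrement of \<open>a\<close> is
    charged at the bound \<open>M\<close>, while the remaining weight \<open>a n\<close> keeps the
    exact partial sum, which the next term of \<open>q\<close> can join.\<close>
  have "(\<Sum>i\<le>n. q i * a i) \<le> (a 0 - a n) * M + a n * sum q {..n}"
  proof (induction n)
    case (Suc n)
    have "a (Suc n) \<le> a n"
      using assms(1) by (simp add: antimonoD)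
    then have "(a n - a (Suc n)) * sum q {..n} \<le> (a n - a (Suc n)) * M"
      using M by (intro mult_left_mono) auto
    with Suc.IH show ?case
      by (simp add: algebra_simps)
  qed simp
  also have "\<dots> \<le> (a 0 - a n) * M + a n * M"
    using assms by (simp add: mult_left_mono)
  finally show ?thesis
    by (simp add: algebra_simps)
qed

section \<open>Feasible plans and their payoffs\<close>

lemma feasible_plans_antimono:
  assumes "x \<in> feasible_plans b T y"
  shows "antimono (\<lambda>t. x (t + T))"
  using assms by (intro decseq_SucI) (auto simp: feasible_plans_def cake_constraint_def)

lemma feasible_plans_bounds:
  assumes "x \<in> feasible_plans b T y"
  shows "0 \<le> x (t + T)" "x (t + T) \<le> b"
  using assms by (auto simp: feasible_plans_def PiE_iff)

lemma feasible_plans_start: "x \<in> feasible_plans b T y \<Longrightarrow> x (0 + T) = y"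
  by (simp add: feasible_plans_def)

lemma summable_payoff_abs:
  assumes "summable (\<lambda>t. \<bar>p t\<bar>)" "x \<in> feasible_plans b T y"
  shows "summable (\<lambda>t. \<bar>p (t + T) * x (t + T)\<bar>)"
proof (rule summable_comparison_test')
  show "summable (\<lambda>t. \<bar>p (t + T)\<bar> * b)"
    using assms(1) by (intro summable_mult2) (simp add: summable_iff_shift[of "\<lambda>t. \<bar>p t\<bar>"])
  show "norm \<bar>p (t + T) * x (t + T)\<bar> \<le> \<bar>p (t + T)\<bar> * b" if "t \<ge> 0" for t
    using feasible_plans_bounds[OF assms(2), of t] by (simp add: abs_mult mult_left_mono)
qed

lemma summable_payoff:
  assumes "summable (\<lambda>t. \<bar>p t\<bar>)" "x \<in> feasible_plans b T y"
  shows "summable (\<lambda>t. p (t + T) * x (t + T))"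
  using summable_payoff_abs[OF assms] by (rule summable_rabs_cancel)

text \<open>\<open>abel_sum_le\<close> bounds every finite truncation of the payoff, and the bound
  passes to the limit.\<close>

lemma payoff_le_partial_sum_bound:
  assumes "summable (\<lambda>t. \<bar>p t\<bar>)" and x: "x \<in> feasible_plans b T y"
    and "\<And>n. (\<Sum>i\<le>n. p (i + T)) \<le> M"
  shows "payoff p T x \<le> y * M"
proof -
  have "(\<lambda>n. \<Sum>i\<le>n. p (i + T) * x (i + T)) \<longlonglongrightarrow> payoff p T x"
    unfolding payoff_def using summable_payoff[OF assms(1) x] by (rule summable_LIMSEQ')
  moreover have "(\<Sum>i\<le>n. p (i + T) * x (i + T)) \<le> y * M" for n
    using abel_sum_le[of "\<lambda>t. x (t + T)" "\<lambda>t. p (t + T)" M n] feasible_plans_antimono[OF x]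
      feasible_plans_bounds(1)[OF x] feasible_plans_start[OF x] assms(3) by simp
  ultimately show ?thesis
    by (intro LIMSEQ_le_const2) auto
qed

lemma constant_plan_feasible:
  "x \<in> {0..b} \<Longrightarrow> (\<lambda>t\<in>{T..}. x) \<in> feasible_plans b T x"
  by (auto simp: feasible_plans_def cake_constraint_def)

lemma payoff_constant_plan:
  assumes "summable (\<lambda>t. \<bar>p t\<bar>)"
  shows "payoff p T (\<lambda>t\<in>{T..}. x) = x * (\<Sum>t. p (t + T))"
proof -
  have "summable (\<lambda>t. p (t + T))"
    using summable_rabs_cancel[OF assms] by (rule summable_ignore_initial_segment)
  then show ?thesis
    by (simp add: payoff_def suminf_mult mult.commute del: summable_iff_shift)
qed

text \<open>The cake stays whole through period \<open>n + T\<close> and is gone afterwards, so the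
  payoff collects exactly \<open>n + 1\<close> prices.\<close>

lemma step_plan_feasible:
  "y \<in> {0..b} \<Longrightarrow> (\<lambda>t\<in>{T..}. if t \<le> n + T then y else 0) \<in> feasible_plans b T y"
  by (auto simp: feasible_plans_def cake_constraint_def)

lemma payoff_step_plan:
  "payoff p T (\<lambda>t\<in>{T..}. if t \<le> n + T then y else 0) = y * (\<Sum>i\<le>n. p (i + T))"
proof -
  have "(\<Sum>t. p (t + T) * (if t \<le> n then y else 0))
      = (\<Sum>t\<le>n. p (t + T) * (if t \<le> n then y else 0))"
    by (rule suminf_finite) auto
  then show ?thesis
    by (simp add: payoff_def sum_distrib_left mult.commute)
qed

section \<open>Existence of optimal plans and the value function\<close>

lemma optimal_plans_iff:
  "x \<in> optimal_plans b p T y \<longleftrightarrow>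
     x \<in> feasible_plans b T y \<and> (\<forall>z\<in>feasible_plans b T y. payoff p T z \<le> payoff p T x)"
  by (auto simp: optimal_plans_def is_arg_max_linorder)

lemma optimal_plans_nonempty:
  assumes p: "summable (\<lambda>t. \<bar>p t\<bar>)" and y: "y \<in> {0..b}"
  shows "optimal_plans b p T y \<noteq> {}"
proof -
  have "summable (\<lambda>t. p (t + T))"
    using summable_rabs_cancel[OF p] by (rule summable_ignore_initial_segment)
  then have "(\<lambda>n. \<Sum>i\<le>n. p (i + T)) \<longlonglongrightarrow> (\<Sum>t. p (t + T))"
    by (rule summable_LIMSEQ')
  \<comment> \<open>Each alternative supplies an attained bound \<open>M\<close>: the full sum of
    the prices for the constant plan, a maximal partial sum for the step plan.\<close>
  then consider "\<And>m. (\<Sum>i\<le>m. p (i + T)) \<le> (\<Sum>t. p (t + T))"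
    | n where "\<And>m. (\<Sum>i\<le>m. p (i + T)) \<le> (\<Sum>i\<le>n. p (i + T))"
    using convergent_max_or_le_limit by blast
  then show ?thesis
  proof cases
    case 1
    then have "(\<lambda>t\<in>{T..}. y) \<in> optimal_plans b p T y"
      unfolding optimal_plans_iff payoff_constant_plan[OF p]
      using constant_plan_feasible[OF y] payoff_le_partial_sum_bound[OF p] by blast
    then show ?thesis
      by blast
  next
    case 2
    then have "(\<lambda>t\<in>{T..}. if t \<le> n + T then y else 0) \<in> optimal_plans b p T y"
      unfolding optimal_plans_iff payoff_step_plan
      using step_plan_feasible[OF y] payoff_le_partial_sum_bound[OF p] by blast
    then show ?thesis
      by blast
  qed
qed

text \<open>Existence of an optimal plan gives meaning to the \<open>the_elem\<close> in
  \<open>value_fun\<close>; this bound and its attainment are then all that later arguments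
  need.\<close>

lemma payoff_le_value_fun:
  assumes "summable (\<lambda>t. \<bar>p t\<bar>)" "y \<in> {0..b}" "x \<in> feasible_plans b T y"
  shows "payoff p T x \<le> value_fun b p T y"
  using optimal_plans_nonempty[OF assms(1,2)] assms(3) value_fun_eq_payoff
  by (force simp: optimal_plans_iff)

lemma value_fun_attained:
  assumes "summable (\<lambda>t. \<bar>p t\<bar>)" "y \<in> {0..b}"
  obtains x where "x \<in> feasible_plans b T y" "value_fun b p T y = payoff p T x"
  using optimal_plans_nonempty[OF assms] value_fun_eq_payoff
  by (metis ex_in_conv optimal_plans_iff)

section \<open>Passing from one period to the next\<close>

lemma payoff_Suc:
  assumes "summable (\<lambda>t. \<bar>p t\<bar>)" "x \<in> feasible_plans b T y"
  shows "payoff p T x = p T * y + payoff p (Suc T) (restrict x {Suc T..})"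
  using suminf_split_head[OF summable_payoff[OF assms]] feasible_plans_start[OF assms(2)]
  by (simp add: payoff_def)

text \<open>The restriction is due to extensionality: a plan from \<open>Suc T\<close> on has to be
  \<open>undefined\<close> at \<open>T\<close>, where \<open>x\<close> has the value
  \<open>y\<close>.\<close>

lemma feasible_plans_tail:
  assumes "x \<in> feasible_plans b T y"
  shows "restrict x {Suc T..} \<in> feasible_plans b (Suc T) (x (Suc T))" "x (Suc T) \<in> {0..y}"
  using assms by (auto simp: feasible_plans_def cake_constraint_def)

text \<open>An optimal plan enters the next period with at most \<open>y\<close>, and by
  monotonicity having all of \<open>y\<close> there is worth at least as much.\<close>

lemma value_fun_le_Suc:
  assumes p: "summable (\<lambda>t. \<bar>p t\<bar>)" and y: "y \<in> {0..b}"
    and mono: "mono_on {0..b} (value_fun b p (Suc T))"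
  shows "value_fun b p T y \<le> p T * y + value_fun b p (Suc T) y"
proof -
  obtain x where x: "x \<in> feasible_plans b T y" "value_fun b p T y = payoff p T x"
    using value_fun_attained[OF p y] .
  have z: "x (Suc T) \<in> {0..b}" "x (Suc T) \<le> y"
    using feasible_plans_tail(2)[OF x(1)] y by auto
  have "payoff p (Suc T) (restrict x {Suc T..}) \<le> value_fun b p (Suc T) (x (Suc T))"
    using payoff_le_value_fun[OF p z(1) feasible_plans_tail(1)[OF x(1)]] .
  also have "\<dots> \<le> value_fun b p (Suc T) y"
    using mono_onD[OF mono z(1) y z(2)] .
  finally show ?thesis
    using payoff_Suc[OF p x(1)] x(2) by simp
qed

text \<open>Iteration of \<open>value_fun_le_Suc\<close>: step \<open>n\<close> uses monotonicity at
  period \<open>Suc (n + T)\<close>, which is later than \<open>T\<close>.\<close>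

lemma value_fun_le_add:
  assumes "summable (\<lambda>t. \<bar>p t\<bar>)" "y \<in> {0..b}" "\<And>t. t > T \<Longrightarrow> mono_on {0..b} (value_fun b p t)"
  shows "value_fun b p T y \<le> (\<Sum>i<n. p (i + T)) * y + value_fun b p (n + T) y"
proof (induction n)
  case (Suc n)
  then show ?case
    using value_fun_le_Suc[OF assms(1,2), of "n + T"] assms(3)[of "Suc (n + T)"]
    by (simp add: algebra_simps)
qed simp

text \<open>This crude bound is a tail of a convergent series, so it makes the remainder in
  \<open>value_fun_le_add\<close> vanish in the limit.\<close>

lemma value_fun_le_tail:
  assumes p: "summable (\<lambda>t. \<bar>p t\<bar>)" and y: "y \<in> {0..b}"
  shows "value_fun b p T y \<le> (\<Sum>t. \<bar>p (t + T)\<bar>) * b"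
proof -
  obtain x where x: "x \<in> feasible_plans b T y" "value_fun b p T y = payoff p T x"
    using value_fun_attained[OF p y] .
  have s: "summable (\<lambda>t. \<bar>p (t + T)\<bar>)"
    using p by (rule summable_ignore_initial_segment)
  have "payoff p T x \<le> (\<Sum>t. \<bar>p (t + T)\<bar> * b)"
    unfolding payoff_def
  proof (rule suminf_le)
    show "p (t + T) * x (t + T) \<le> \<bar>p (t + T)\<bar> * b" for t
      using feasible_plans_bounds[OF x(1), of t] by (intro mult_mono) auto
  qed (use s summable_payoff[OF p x(1)] in \<open>auto intro: summable_mult2\<close>)
  with x(2) s show ?thesis
    by (simp add: suminf_mult2)
qed

section \<open>Optimality of the constant plan and the decision rule\<close>

lemma constant_plan_optimal:
  assumes p: "summable (\<lambda>t. \<bar>p t\<bar>)" and x: "x \<in> {0..b}"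
    and mono: "\<And>t. t > T \<Longrightarrow> mono_on {0..b} (value_fun b p t)"
  shows "(\<lambda>t\<in>{T..}. x) \<in> optimal_plans b p T x"
proof -
  have s: "summable (\<lambda>t. p (t + T))" "summable (\<lambda>t. \<bar>p (t + T)\<bar>)"
    using summable_ignore_initial_segment[OF summable_rabs_cancel[OF p]]
      summable_ignore_initial_segment[OF p] by auto
  have "(\<lambda>n. \<Sum>t. \<bar>p (t + n + T)\<bar>) \<longlonglongrightarrow> 0"
  proof -
    \<comment> \<open>A tail is the total minus a partial sum.\<close>
    have "(\<lambda>n. (\<Sum>t. \<bar>p (t + T)\<bar>) - (\<Sum>i<n. \<bar>p (i + T)\<bar>)) \<longlonglongrightarrow> 0"
      using tendsto_diff[OF tendsto_const[of "\<Sum>t. \<bar>p (t + T)\<bar>"] summable_LIMSEQ[OF s(2)]] by simp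
    then show ?thesis
      using suminf_minus_initial_segment[OF s(2)] by simp
  qed
  then have "(\<lambda>n. (\<Sum>i<n. p (i + T)) * x + (\<Sum>t. \<bar>p (t + n + T)\<bar>) * b)
      \<longlonglongrightarrow> (\<Sum>t. p (t + T)) * x + 0 * b"
    by (intro tendsto_intros summable_LIMSEQ[OF s(1)])
  moreover have "value_fun b p T x \<le> (\<Sum>i<n. p (i + T)) * x + (\<Sum>t. \<bar>p (t + n + T)\<bar>) * b" for n
    using value_fun_le_add[OF p x, of T n] mono value_fun_le_tail[OF p x, of "n + T"]
    by (force simp: add.assoc)
  ultimately have "value_fun b p T x \<le> (\<Sum>t. p (t + T)) * x + 0 * b"
    by (intro LIMSEQ_le_const) auto
  \<comment> \<open>The limit is the payoff of the constant plan, which therefore bounds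
    \<open>value_fun\<close> and with it every payoff.\<close>
  then show ?thesis
    unfolding optimal_plans_iff payoff_constant_plan[OF p]
    using constant_plan_feasible[OF x] payoff_le_value_fun[OF p x]
    by (force simp: mult.commute)
qed

theorem proposition6p2:
  fixes b :: real and p :: "nat \<Rightarrow> real" and T :: nat
  assumes "b > 0"
    and "summable (\<lambda>t. \<bar>p t\<bar>)"
  shows "(mono_on {0..b} (value_fun b p (Suc T)) \<longrightarrow>
            (\<forall>x\<in>{0..b}. x \<in> decision_rule b p T x)) \<and>
         (strict_mono_on {0..b} (value_fun b p (Suc T)) \<longrightarrow>
            (\<forall>x\<in>{0..b}. decision_rule b p T x = {x})) \<and>
         ((\<forall>t>T. mono_on {0..b} (value_fun b p t)) \<longrightarrow>
            (\<forall>x\<in>{0..b}. (\<lambda>t\<in>{T..}. x) \<in> optimal_plans b p T x))"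
proof -
  \<comment> \<open>The point \<open>x\<close> is the greatest element of \<open>{0..x}\<close>, so
    a non-decreasing function is maximal there.\<close>
  have i: "x \<in> decision_rule b p T x"
    if "mono_on {0..b} (value_fun b p (Suc T))" "x \<in> {0..b}" for x
    using that(2) mono_onD[OF that(1)] by (auto simp: decision_rule_def is_arg_max_linorder)
  have "decision_rule b p T x = {x}"
    if strict: "strict_mono_on {0..b} (value_fun b p (Suc T))" and x: "x \<in> {0..b}" for x
  proof -
    have "y = x" if y: "y \<in> decision_rule b p T x" for y
    proof (rule ccontr)
      assume "y \<noteq> x"
      with y x have "value_fun b p (Suc T) y < value_fun b p (Suc T) x"
        by (intro strict_mono_onD[OF strict]) (auto simp: decision_rule_def is_arg_max_def)
      with y x show False
        by (auto simp: decision_rule_def is_arg_max_def)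
    qed
    \<comment> \<open>Uniqueness alone would allow an empty set of maximizers; part (i) supplies the
      element \<open>x\<close>.\<close>
    then show ?thesis
      using i[OF strict_mono_on_imp_mono_on[OF strict] x] by blast
  qed
  with i show ?thesis
    using constant_plan_optimal[OF assms(2)] by blast
qed

end
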